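(* Let $n\ge 1$. Consider systems $A\cdot \mathbf{x}=\mathbf{b}$ of $n$ linear equations with invertible $A\in\mathbb{R}^{n\times n}$ and right-hand side $\mathbf{b}\in\mathbb{R}^n$, regarded as the map $(A,\mathbf{b})\mapsto \mathbf{x}=A^{-1}\cdot\mathbf{b}\in\mathbb{R}^n$ with active inputs $A$ (ranging over the invertible matrices) and $\mathbf{b}$ and active output $\mathbf{x}$. Then for every such $(A,\mathbf{b})$, with primal solution $\mathbf{x}=A^{-1}\cdot\mathbf{b}$, and every $\mathbf{x}_{(1)}\in\mathbb{R}^n$, the adjoints $\mathbf{b}_{(1)}\in\mathbb{R}^n$ of $\mathbf{b}$ and $A_{(1)}\in\mathbb{R}^{n\times n}$ of $A$ corresponding to $\mathbf{x}_{(1)}$ are $$\mathbf{b}_{(1)}=A^{-T}\cdot\mathbf{x}_{(1)},\qquad A_{(1)}=-\mathbf{b}_{(1)}\cdot\mathbf{x}^T .$$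
   Context: Tangents and adjoints. Let $F$ be a differentiable map $\mathbf{y}=F(\mathbf{x})$ from (an open subset of) $\mathbb{R}^N$ to $\mathbb{R}^M$ with Jacobian $\nabla F=\nabla F(\mathbf{x})\in\mathbb{R}^{M\times N}$. The tangent of $F$ at $\mathbf{x}$ is the linear map $\mathbf{x}^{(1)}\mapsto \mathbf{y}^{(1)}=\nabla F\cdot\mathbf{x}^{(1)}$. The adjoint of $F$ at $\mathbf{x}$ is the linear map $\mathbf{y}_{(1)}\mapsto \mathbf{x}_{(1)}=\nabla F^*\cdot\mathbf{y}_{(1)}$ from $\mathbb{R}^M$ to $\mathbb{R}^N$ determined by $\langle \nabla F\cdot\mathbf{x}^{(1)},\mathbf{y}_{(1)}\rangle=\langle \mathbf{x}^{(1)},\nabla F^*\cdot\mathbf{y}_{(1)}\rangle$ for all $\mathbf{x}^{(1)}\in\mathbb{R}^N$, $\mathbf{y}_{(1)}\in\mathbb{R}^M$, with the Euclidean inner product. Active variables are those inputs with respect to which, and outputs of which, derivatives are computed; when there are several active inputs they are concatenated into one input vector, and $\mathbf{x}_{(1)}$ splits into the adjoints of the individual inputs. Matrices are identified with vectors of their entries (serialization), so the inner product of two matrices of equal size is the sum of products of corresponding entries. Superscript ${}^{(1)}$ marks tangents and subscript ${}_{(1)}$ marks adjoints; an adjoint has the same shape as its variable. $A^{-T}=(A^{-1})^T$. *)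

theory Defs
  imports "HOL-Analysis.Analysis"
begin

definition tangent_map :: "('a::euclidean_space \<Rightarrow> 'b::euclidean_space) \<Rightarrow> 'a \<Rightarrow> 'a \<Rightarrow> 'b" where
  "tangent_map F x = frechet_derivative F (at x)"

definition adjoint_map :: "('a::euclidean_space \<Rightarrow> 'b::euclidean_space) \<Rightarrow> 'a \<Rightarrow> 'b \<Rightarrow> 'a" where
  "adjoint_map F x = adjoint (tangent_map F x)"

(* The inner product on the input type is the serialized Euclidean one:
   (A, b) \<bullet> (C, d) = (\<Sum>i j. A$i$j * C$i$j) + (\<Sum>i. b$i * d$i).
   At singular A the value is unspecified; since the invertible matrices form an
   open set, the derivative at an invertible A does not depend on it. *)
definition lin_solve :: "(real^'n^'n) \<times> (real^'n) \<Rightarrow> real^'n" where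
  "lin_solve = (\<lambda>(A, b). matrix_inv A *v b)"

end

theory Submission
  imports Defs
begin

text \<open>The map \<open>(B, c) \<mapsto> (B, B\<^sup>-\<^sup>1 c)\<close> is a local inverse of the polynomial map
  \<open>(B, y) \<mapsto> (B, B y)\<close>, whose derivative at \<open>(A, x)\<close> is \<open>(C, d) \<mapsto> (C, C x + A d)\<close>. The inverse
  function theorem therefore gives both differentiability of \<open>lin_solve\<close> and the tangent
  \<open>(C, d) \<mapsto> A\<^sup>-\<^sup>1 (d - C x)\<close>, whose adjoint is read off from
  \<open>(C x) \<bullet> v = C \<bullet> (v x\<^sup>T)\<close>.\<close>

lemma matrix_inv_mult:
  fixes A :: "'a::semiring_1^'n^'m"
  assumes "invertible A"
  shows "A ** matrix_inv A = mat 1" "matrix_inv A ** A = mat 1"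
  using someI_ex[OF assms[unfolded invertible_def]] by (simp_all add: matrix_inv_def)

lemma bounded_bilinear_matrix_vector_mult:
  "bounded_bilinear ((*v) :: real^'n^'m \<Rightarrow> real^'n \<Rightarrow> real^'m)"
  unfolding bilinear_conv_bounded_bilinear[symmetric] bilinear_def
  by (auto intro!: linearI simp: matrix_vector_mult_add_rdistrib scaleR_matrix_vector_assoc
      matrix_vector_right_distrib matrix_vector_mult_scaleR)

text \<open>Preimage of the nonzero reals under the determinant, a polynomial in the entries. It
  supplies the open domain for the inverse function theorem.\<close>

lemma open_invertible_matrices: "open {A :: real^'n^'n. invertible A}"
proof -
  have "continuous_on UNIV (det :: real^'n^'n \<Rightarrow> real)"
    unfolding det_def by (intro continuous_intros)
  then have "open (det -` (- {0}) :: (real^'n^'n) set)"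
    by (intro open_vimage) auto
  then show ?thesis
    by (simp add: invertible_det_nz vimage_def)
qed

text \<open>Both sides are the sum of \<open>v$i * C$i$j * x$j\<close>; thus the adjoint of
  \<open>C \<mapsto> C *v x\<close> sends \<open>v\<close> to the outer product of \<open>v\<close>
  and \<open>x\<close>.\<close>

lemma inner_matrix_vector_mult:
  fixes C :: "real^'n^'m"
  shows "(C *v x) \<bullet> v =
    C \<bullet> ((columnvector v :: real^1^'m) ** (rowvector x :: real^'n^1))"
  by (simp add: inner_vec_def matrix_vector_mult_def matrix_matrix_mult_def
      columnvector_def rowvector_def sum_distrib_left sum_distrib_right mult_ac)

lemma has_derivative_lin_solve:
  fixes A :: "real^'n^'n"
  assumes A: "invertible A"
  shows "(lin_solve has_derivative
    (\<lambda>(C, d). matrix_inv A *v (d - C *v lin_solve (A, b)))) (at (A, b))"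
proof -
  define x where "x = lin_solve (A, b)"
  \<comment> \<open>Carrying the matrix along makes domain and codomain the same space, as the
    inverse function theorem requires.\<close>
  define f where "f = (\<lambda>p :: (real^'n^'n) \<times> (real^'n). (fst p, fst p *v snd p))"
  define g where "g = (\<lambda>p :: (real^'n^'n) \<times> (real^'n). (fst p, lin_solve p))"
  \<comment> \<open>Obtained by solving \<open>A *v e + C *v x = d\<close> for
    \<open>e\<close>.\<close>
  define g' where "g' = (\<lambda>(C, d). (C :: real^'n^'n, matrix_inv A *v (d - C *v x)))"
  note bb = bounded_bilinear_matrix_vector_mult
  have "(g has_derivative g') (at (A, b))"
  proof (rule has_derivative_inverse_strong_x)
    show "open ({B :: real^'n^'n. invertible B} \<times> (UNIV :: (real^'n) set))"
      by (intro open_Times open_invertible_matrices open_UNIV)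
    show "g (A, b) \<in> {B. invertible B} \<times> UNIV"
      by (simp add: g_def A)
    show "continuous_on ({B. invertible B} \<times> UNIV) f"
      unfolding f_def by (intro continuous_intros bounded_bilinear.continuous_on[OF bb])
    show "g (f p) = p" if "p \<in> {B. invertible B} \<times> UNIV" for p
      using that
      by (auto simp: f_def g_def lin_solve_def matrix_vector_mul_assoc matrix_inv_mult)
    \<comment> \<open>The base point \<open>g (A, b)\<close> is \<open>(A, x)\<close>, so the
      product rule gives this derivative.\<close>
    show "(f has_derivative (\<lambda>p. (fst p, A *v snd p + fst p *v x))) (at (g (A, b)))"
      unfolding f_def g_def
      by (auto intro!: derivative_eq_intros bounded_bilinear.FDERIV[OF bb] simp: x_def)
    show "(\<lambda>p. (fst p, A *v snd p + fst p *v x)) \<circ> g' = id"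
      by (auto simp: fun_eq_iff g'_def matrix_vector_mul_assoc matrix_inv_mult[OF A])
    show "f (g (A, b)) = (A, b)"
      by (simp add: f_def g_def lin_solve_def matrix_vector_mul_assoc matrix_inv_mult[OF A])
  qed
  from has_derivative_snd[OF this] show ?thesis
    by (simp add: g_def g'_def x_def case_prod_unfold)
qed

lemma adjoint_map_lin_solve:
  fixes A :: "real^'n^'n"
  assumes A: "invertible A"
  shows "adjoint_map lin_solve (A, b) v =
    (let w = transpose (matrix_inv A) *v v
     in (- ((columnvector w :: real^1^'n) ** (rowvector (lin_solve (A, b)) :: real^'n^1)), w))"
proof -
  define x where "x = lin_solve (A, b)"
  define G where "G = (\<lambda>v. let w = transpose (matrix_inv A) *v v
    in (- ((columnvector w :: real^1^'n) ** (rowvector x :: real^'n^1)), w))"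
  have "tangent_map lin_solve (A, b) = (\<lambda>(C, d). matrix_inv A *v (d - C *v x))"
    unfolding tangent_map_def x_def
    by (rule frechet_derivative_at[symmetric, OF has_derivative_lin_solve[OF A]])
  moreover have "(matrix_inv A *v (d - C *v x)) \<bullet> v = (C, d) \<bullet> G v" for C d v
  proof -
    \<comment> \<open>Moving the inverse across the inner product produces \<open>w\<close>; the
      \<open>d\<close> term then yields the second component of \<open>G v\<close> and the
      \<open>C\<close> term the first.\<close>
    have "(matrix_inv A *v (d - C *v x)) \<bullet> v = (d - C *v x) \<bullet> (transpose (matrix_inv A) *v v)"
      by (metis dot_lmul_matrix inner_commute transpose_matrix_vector)
    then show ?thesis
      by (simp add: G_def Let_def inner_diff_left inner_matrix_vector_mult)
  qed
  \<comment> \<open>The pairing identity for all \<open>(C, d)\<close> and \<open>v\<close>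
    determines the adjoint.\<close>
  ultimately have "adjoint_map lin_solve (A, b) = G"
    unfolding adjoint_map_def by (intro adjoint_unique) auto
  then show ?thesis
    by (simp add: G_def x_def)
qed

theorem theorem4p3:
  fixes A A\<^sub>1 :: "real^'n^'n" and b b\<^sub>1 x x\<^sub>1 :: "real^'n"
  assumes "invertible A"
    and "x = lin_solve (A, b)"
    and "(A\<^sub>1, b\<^sub>1) = adjoint_map lin_solve (A, b) x\<^sub>1"
  shows "lin_solve differentiable (at (A, b)) \<and>
         b\<^sub>1 = transpose (matrix_inv A) *v x\<^sub>1 \<and>
         A\<^sub>1 = - ((columnvector b\<^sub>1 :: real^1^'n) ** (rowvector x :: real^'n^1))"
proof (intro conjI)
  show "lin_solve differentiable (at (A, b))"
    using has_derivative_lin_solve[OF assms(1)] by (rule differentiableI)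
qed (use assms adjoint_map_lin_solve[OF assms(1)] in \<open>auto simp: Let_def\<close>)

end
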